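(* Let $\beta\in(1/2,1)$, let $\Omega=(a,b)$ be a bounded interval, let $M$ be the number of cells of a uniform mesh of $\Omega$ with step size $h=(b-a)/M$, and let $A_h^\beta=(a^h_{i,j})_{(M-1)\times(M-1)}$ be the stiffness matrix defined in the context. Then $A_h^\beta$ is symmetric and satisfies: 1. $a^h_{i,i}>0$ for $i=1,\dots,M-1$; 2. $a^h_{i,j}<0$ for $i\neq j$, $i,j=1,\dots,M-1$; 3. $\sum_{j=1}^{M-1}a^h_{i,j}>0$ for $i=1,\dots,M-1$; 4. in the particular case $h\le 1/7$, $$\sum_{j=1}^{M-1}a^h_{i,j}\ \ge\ \begin{cases}-\dfrac{h^{1-2\beta}(4-2^{3-2\beta})}{2\cos(\beta\pi)\Gamma(4-2\beta)}, & i=1,\,M-1,\\[2mm] -\dfrac{2^{2\beta}h(2\beta-1)}{\cos(\beta\pi)\Gamma(2-2\beta)}, & i=2,\dots,M-2;\end{cases}$$ 5. $A_h^\beta$ is an M-matrix.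
   Context: The stiffness matrix $A_h^\beta=(a^h_{i,j})_{(M-1)\times(M-1)}$ arises from piecewise linear finite elements for the Riesz derivative of order $2\beta$ on the uniform mesh $x_i=a+ih$, $i=0,\dots,M$, with homogeneous Dirichlet conditions. Its entries are $$a^h_{i,i}=\frac{h^{1-2\beta}(2^{4-2\beta}-8)}{2\cos(\beta\pi)\Gamma(4-2\beta)},\quad i=1,\dots,M-1,$$ $$a^h_{j,j+1}=a^h_{j+1,j}=\frac{h^{1-2\beta}(3^{3-2\beta}-2^{5-2\beta}+7)}{2\cos(\beta\pi)\Gamma(4-2\beta)},\quad j=1,\dots,M-2,$$ and, for $l\ge 2$ and $k=1,\dots,M-l-1$, $$a^h_{k,k+l}=a^h_{k+l,k}=\frac{h^{1-2\beta}}{2\cos(\beta\pi)\Gamma(4-2\beta)}\Big[(l+2)^{3-2\beta}-4(l+1)^{3-2\beta}+6l^{3-2\beta}-4(l-1)^{3-2\beta}+(l-2)^{3-2\beta}\Big].$$ Here $\Gamma$ is the Gamma function.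
   Formalization: In item 4, the bound for i=2,…,M-2 is stated only for intervals with b-a ≤ 1; for longer intervals it is false (e.g. β=3/4, b-a=2, M=14, i=7: row sum about 0.064, claimed bound about 0.161). *)

theory Defs
  imports "HOL-Analysis.Gamma_Function" "Jordan_Normal_Form.Matrix"
begin

(* Entry a_{i,j} depends on i and j only through l = |i - j|.  For l = 2 the last term is
   0 powr (3 - 2 * \<beta>), which Isabelle evaluates to 0, as intended since 3 - 2 * \<beta> > 0. *)
definition riesz_stiffness_coeff :: "real \<Rightarrow> real \<Rightarrow> nat \<Rightarrow> real" where
  "riesz_stiffness_coeff \<beta> h l =
     h powr (1 - 2 * \<beta>) / (2 * cos (\<beta> * pi) * Gamma (4 - 2 * \<beta>)) *
     (if l = 0 then 2 powr (4 - 2 * \<beta>) - 8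
      else if l = 1 then 3 powr (3 - 2 * \<beta>) - 2 powr (5 - 2 * \<beta>) + 7
      else (real l + 2) powr (3 - 2 * \<beta>) - 4 * (real l + 1) powr (3 - 2 * \<beta>)
           + 6 * real l powr (3 - 2 * \<beta>) - 4 * (real l - 1) powr (3 - 2 * \<beta>)
           + (real l - 2) powr (3 - 2 * \<beta>))"

(* Matrix indices start at 0, so the mathematical a_{i,j} with 1 \<le> i, j \<le> M - 1 is the
   entry at position (i - 1, j - 1). *)
definition riesz_stiffness_mat :: "real \<Rightarrow> real \<Rightarrow> nat \<Rightarrow> real mat" where
  "riesz_stiffness_mat \<beta> h M =
     mat (M - 1) (M - 1) (\<lambda>(i, j). riesz_stiffness_coeff \<beta> h (nat \<bar>int i - int j\<bar>))"

(* M-matrix in the sense usual in numerical analysis (Varga): nonpositive off-diagonal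
   entries, nonsingular, entrywise nonnegative inverse. *)
definition M_matrix :: "real mat \<Rightarrow> bool" where
  "M_matrix A \<longleftrightarrow>
     square_mat A \<and>
     (\<forall>i<dim_row A. \<forall>j<dim_row A. i \<noteq> j \<longrightarrow> A $$ (i, j) \<le> 0) \<and>
     (\<exists>B \<in> carrier_mat (dim_row A) (dim_row A).
        inverts_mat A B \<and> inverts_mat B A \<and>
        (\<forall>i<dim_row A. \<forall>j<dim_row A. 0 \<le> B $$ (i, j)))"

end

theory Submission
  imports Defs "Jordan_Normal_Form.Determinant"
begin

text \<open>
  Put \<open>s = 3 - 2 \<beta> \<in> (1, 2)\<close>. Up to a negative constant, the entry with offset \<open>k\<close> is the
  fourth difference of \<open>\<lambda>x. \<bar>x\<bar> powr s\<close> at \<open>k\<close>, so a row sum telescopes to a sum of two third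
  differences \<open>T p + T q\<close>. By the mean value theorem, \<open>T p\<close> is a second difference of the
  concave function \<open>\<lambda>x. x powr (s - 1)\<close>, which Taylor expansion and the convexity of
  \<open>\<lambda>x. x powr (s - 3)\<close> bound away from 0. Midpoint convexity combines the bounds at \<open>p\<close> and
  \<open>q\<close>. Finally, a strictly diagonally dominant matrix with nonpositive off-diagonal entries
  satisfies a discrete minimum principle, hence has a nonnegative inverse.
\<close>

section \<open>Differences of powers\<close>

text \<open>AM-GM is used twice: for \<open>a\<close>, \<open>b\<close> under the nonincreasing
  power, then for the half powers \<open>a powr (q / 2)\<close> and
  \<open>b powr (q / 2)\<close>.\<close>

lemma powr_midpoint_le:
  fixes a b q :: real
  assumes "0 < a" "0 < b" "q \<le> 0"
  shows "2 * ((a + b) / 2) powr q \<le> a powr q + b powr q"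
proof -
  have "sqrt (a * b) \<le> (a + b) / 2"
    using arith_geo_mean_sqrt[of a b] assms by simp
  then have "((a + b) / 2) powr q \<le> sqrt (a * b) powr q"
    using assms by (intro powr_mono2') auto
  also have "\<dots> = a powr (q / 2) * b powr (q / 2)"
    using assms by (simp add: powr_half_sqrt[symmetric] powr_powr powr_mult)
  finally have "2 * ((a + b) / 2) powr q \<le> 2 * (a powr (q / 2) * b powr (q / 2))"
    by simp
  also have "\<dots> \<le> (a powr (q / 2))\<^sup>2 + (b powr (q / 2))\<^sup>2"
    using sum_squares_bound[of "a powr (q / 2)" "b powr (q / 2)"] by simp
  also have "\<dots> = a powr q + b powr q"
    using assms by (simp add: power2_eq_square powr_add[symmetric])
  finally show ?thesis .
qed

text \<open>Strictness comes from the first AM-GM alone: \<open>a \<noteq> b\<close>, and the power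
  is strictly decreasing for \<open>q < 0\<close>.\<close>

lemma powr_midpoint_less:
  fixes a b q :: real
  assumes "0 < a" "a < b" "q < 0"
  shows "2 * ((a + b) / 2) powr q < a powr q + b powr q"
proof -
  have "a * b < ((a + b) / 2)\<^sup>2"
  proof -
    have "0 < (a - b)\<^sup>2" using assms by simp
    then show ?thesis by (simp add: power2_eq_square field_simps)
  qed
  then have "sqrt (a * b) < (a + b) / 2"
    using assms by (intro real_less_lsqrt) auto
  then have "((a + b) / 2) powr q < sqrt (a * b) powr q"
    using assms by (intro powr_less_mono2_neg) auto
  also have "\<dots> = a powr (q / 2) * b powr (q / 2)"
    using assms by (simp add: powr_half_sqrt[symmetric] powr_powr powr_mult)
  finally have "2 * ((a + b) / 2) powr q < 2 * (a powr (q / 2) * b powr (q / 2))"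
    by simp
  also have "\<dots> \<le> (a powr (q / 2))\<^sup>2 + (b powr (q / 2))\<^sup>2"
    using sum_squares_bound[of "a powr (q / 2)" "b powr (q / 2)"] by simp
  also have "\<dots> = a powr q + b powr q"
    using assms by (simp add: power2_eq_square powr_add[symmetric])
  finally show ?thesis .
qed

section \<open>Derivatives of shifted powers and central second differences\<close>

lemma powr_plus_has_derivative:
  fixes x c r :: real
  assumes "0 < x + c"
  shows "((\<lambda>x. (x + c) powr r) has_real_derivative r * (x + c) powr (r - 1)) (at x)"
  using DERIV_shift[of "\<lambda>x. x powr r" "r * (x + c) powr (r - 1)" x c]
    has_real_derivative_powr[OF assms, of r] by simp

lemma powr_minus_has_derivative:
  fixes x c r :: real
  assumes "0 < c - x"
  shows "((\<lambda>x. (c - x) powr r) has_real_derivative - (r * (c - x) powr (r - 1))) (at x)"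
  using assms by (auto intro!: derivative_eq_intros)

definition second_diff_powr :: "real \<Rightarrow> real \<Rightarrow> real" where
  "second_diff_powr r x = (x + 1) powr r - 2 * x powr r + (x - 1) powr r"

lemma second_diff_powr_has_derivative:
  assumes "1 < x"
  shows "(second_diff_powr r has_real_derivative r * second_diff_powr (r - 1) x) (at x)"
  using powr_plus_has_derivative[of x 1 r] powr_plus_has_derivative[of x "-1" r]
    has_real_derivative_powr[of x r] assms
  unfolding second_diff_powr_def[abs_def]
  by (auto intro!: derivative_eq_intros simp: algebra_simps)

text \<open>The endpoint 1, where \<open>x - 1\<close> vanishes, is included because the exponent is
  positive; the mean value theorem on [1, 2] relies on it.\<close>

lemma continuous_on_second_diff_powr:
  assumes "0 < r"
  shows "continuous_on {1..} (second_diff_powr r)"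
  unfolding second_diff_powr_def[abs_def]
  using assms by (intro continuous_intros continuous_on_powr') auto

lemma second_diff_powr_pos:
  assumes "r < 0" "1 < x"
  shows "0 < second_diff_powr r x"
  using powr_midpoint_less[of "x - 1" "x + 1" r] assms by (simp add: second_diff_powr_def)

text \<open>The derivative is \<open>r\<close> times a second difference with exponent
  \<open>r - 1 < 0\<close>, positive by strict convexity.\<close>

lemma second_diff_powr_strict_mono:
  assumes "0 < r" "r < 1" "1 < x" "x < y"
  shows "second_diff_powr r x < second_diff_powr r y"
proof (rule DERIV_pos_imp_increasing[OF \<open>x < y\<close>])
  fix z assume "x \<le> z" "z \<le> y"
  then have "1 < z" using assms by simp
  then show "\<exists>d. (second_diff_powr r has_real_derivative d) (at z) \<and> 0 < d"
    using second_diff_powr_has_derivative[of z r] second_diff_powr_pos[of "r - 1" z] assms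
    by (metis diff_less_0_iff_less mult_pos_pos)
qed

text \<open>Second-order Taylor estimate in the step size \<open>v\<close>, taken from 0 to 1 with
  \<open>x\<close> fixed: \<open>g\<close> and its derivative \<open>d\<close> vanish at 0, and
  \<open>d\<close> is nondecreasing by midpoint convexity with exponent
  \<open>r - 2\<close>.\<close>

lemma second_diff_powr_le:
  assumes "0 < r" "r < 1" "1 < x"
  shows "second_diff_powr r x \<le> - (r * (1 - r) * x powr (r - 2))"
proof -
  \<comment> \<open>This value of \<open>c\<close> makes the derivative of \<open>d\<close> vanish
    at 0.\<close>
  define c where "c = r * (1 - r) * x powr (r - 2)"
  define d where "d v = r * ((x - v) powr (r - 1) - (x + v) powr (r - 1)) - 2 * c * v" for v
  define g where "g v = 2 * x powr r - (x + v) powr r - (x - v) powr r - c * v\<^sup>2" for v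
  have d: "0 \<le> d v" if "0 \<le> v" "v \<le> 1" for v
  proof -
    have "d 0 \<le> d v"
    proof (rule DERIV_nonneg_imp_nondecreasing[OF \<open>0 \<le> v\<close>])
      fix u assume u: "0 \<le> u" "u \<le> v"
      let ?e = "r * (1 - r) * ((x - u) powr (r - 2) + (x + u) powr (r - 2)) - 2 * c"
      have "(d has_real_derivative ?e) (at u)"
        using powr_plus_has_derivative[of u x "r - 1"] powr_minus_has_derivative[of x u "r - 1"]
          u that assms unfolding d_def[abs_def]
        by (auto intro!: derivative_eq_intros simp: algebra_simps)
      moreover have "0 \<le> ?e"
      proof -
        have "2 * x powr (r - 2) \<le> (x - u) powr (r - 2) + (x + u) powr (r - 2)"
          using powr_midpoint_le[of "x - u" "x + u" "r - 2"] u that assms by simp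
        then have "r * (1 - r) * (2 * x powr (r - 2))
            \<le> r * (1 - r) * ((x - u) powr (r - 2) + (x + u) powr (r - 2))"
          using assms by (intro mult_left_mono) auto
        then show ?thesis by (simp add: c_def)
      qed
      ultimately show "\<exists>e. (d has_real_derivative e) (at u) \<and> 0 \<le> e" by blast
    qed
    then show ?thesis by (simp add: d_def)
  qed
  have "g 0 \<le> g 1"
  proof (rule DERIV_nonneg_imp_nondecreasing[where f = g and a = 0 and b = 1])
    fix v :: real assume v: "0 \<le> v" "v \<le> 1"
    have "(g has_real_derivative d v) (at v)"
      using powr_plus_has_derivative[of v x r] powr_minus_has_derivative[of x v r]
        v assms unfolding g_def[abs_def] d_def
      by (auto intro!: derivative_eq_intros simp: algebra_simps)
    then show "\<exists>e. (g has_real_derivative e) (at v) \<and> 0 \<le> e" using d[OF v] by blast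
  qed simp
  then show ?thesis by (simp add: g_def c_def second_diff_powr_def)
qed

section \<open>Third differences of the even function |x|^s\<close>

definition third_diff_powr :: "real \<Rightarrow> real \<Rightarrow> real" where
  "third_diff_powr s x =
     \<bar>x + 2\<bar> powr s - 3 * \<bar>x + 1\<bar> powr s + 3 * \<bar>x\<bar> powr s - \<bar>x - 1\<bar> powr s"

text \<open>The nodes run from \<open>x - 1\<close> to \<open>x + 2\<close>, so evenness of |x|^s
  makes the third difference antisymmetric about -1/2.\<close>

lemma third_diff_powr_minus: "third_diff_powr s (- x) = - third_diff_powr s (x - 1)"
proof -
  have "\<bar>- x + 2\<bar> = \<bar>x - 2\<bar>" "\<bar>- x + 1\<bar> = \<bar>x - 1\<bar>" "\<bar>- x - 1\<bar> = \<bar>x + 1\<bar>" by auto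
  then show ?thesis by (simp add: third_diff_powr_def add.commute)
qed

lemma third_diff_powr_0: "third_diff_powr s 0 = 2 powr s - 4"
  by (simp add: third_diff_powr_def)

text \<open>For \<open>1 \<le> x\<close> the absolute values drop out and the third difference is
  the increment of \<open>second_diff_powr s\<close> over [x, x + 1].\<close>

lemma third_diff_powr_mvt:
  assumes "1 < s" "1 \<le> x"
  obtains z where "x < z" "z < x + 1" "third_diff_powr s x = s * second_diff_powr (s - 1) z"
proof -
  have "continuous_on {x..x + 1} (second_diff_powr s)"
    using assms by (intro continuous_on_subset[OF continuous_on_second_diff_powr]) auto
  moreover have "second_diff_powr s differentiable (at z)" if "x < z" for z
    using second_diff_powr_has_derivative[of z s] that assms
    by (auto simp: real_differentiable_def)
  ultimately obtain l z where z: "x < z" "z < x + 1"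
    and l: "(second_diff_powr s has_real_derivative l) (at z)"
      "second_diff_powr s (x + 1) - second_diff_powr s x = (x + 1 - x) * l"
    using MVT[of x "x + 1" "second_diff_powr s"] by auto
  have "l = s * second_diff_powr (s - 1) z"
    using DERIV_unique[OF l(1) second_diff_powr_has_derivative[of z s]] z assms by simp
  moreover have "third_diff_powr s x = second_diff_powr s (x + 1) - second_diff_powr s x"
    using assms by (simp add: third_diff_powr_def second_diff_powr_def add.commute)
  ultimately show thesis using that z l(2) by simp
qed

text \<open>The unknown point \<open>z\<close> is replaced by the larger \<open>x + 1\<close>, since
  the power with exponent \<open>s - 3\<close> decreases.\<close>

lemma third_diff_powr_le:
  assumes "1 < s" "s < 2" "1 \<le> x"
  shows "third_diff_powr s x \<le> - (s * (s - 1) * (2 - s) * (x + 1) powr (s - 3))"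
proof -
  obtain z where z: "x < z" "z < x + 1" "third_diff_powr s x = s * second_diff_powr (s - 1) z"
    using third_diff_powr_mvt assms by blast
  have "(x + 1) powr (s - 3) \<le> z powr (s - 3)"
    using z assms by (intro powr_mono2') auto
  then have "(s - 1) * (2 - s) * (x + 1) powr (s - 3) \<le> (s - 1) * (2 - s) * z powr (s - 3)"
    using assms by (intro mult_left_mono) auto
  also have "\<dots> \<le> - second_diff_powr (s - 1) z"
    using second_diff_powr_le[of "s - 1" z] z assms by simp
  finally have "s * ((s - 1) * (2 - s) * (x + 1) powr (s - 3)) \<le> s * - second_diff_powr (s - 1) z"
    using assms by (intro mult_left_mono) auto
  then show ?thesis using z by (simp add: mult.assoc)
qed

lemma third_diff_powr_neg:
  assumes "1 < s" "s < 2"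
  shows "third_diff_powr s (real n) < 0"
proof (cases "n = 0")
  case True
  have "2 powr s < 2 powr 2" using assms by (intro powr_less_mono) auto
  then show ?thesis using True by (simp add: third_diff_powr_0)
next
  case False
  have "0 < s * (s - 1) * (2 - s) * (real n + 1) powr (s - 3)" using assms by simp
  moreover have "third_diff_powr s (real n) \<le> - (s * (s - 1) * (2 - s) * (real n + 1) powr (s - 3))"
    using third_diff_powr_le False assms by simp
  ultimately show ?thesis by linarith
qed

text \<open>At exponent 2 the expression is 9 - 16 + 7 = 0, so it suffices that it decreases
  strictly up to 2. This is the offset-1 entry, out of reach of the mean value argument.\<close>

lemma powr_3_4_2_pos:
  assumes "0 \<le> s" "s < (2::real)"
  shows "0 < 3 powr s - 4 * 2 powr s + 7"
proof -
  define f :: "real \<Rightarrow> real" where "f x = 3 powr x - 4 * 2 powr x + 7" for x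
  have "f 2 < f s"
  proof (rule DERIV_neg_imp_decreasing[OF assms(2)])
    fix x assume x: "s \<le> x" "x \<le> 2"
    \<comment> \<open>Factoring out \<open>2 powr x\<close> and using (3/2)^x <= 9/4 reduces the
      sign of the derivative to 9 ln 3 < 16 ln 2, that is 3^9 < 2^16.\<close>
    have "(3::real) powr x = (3/2) powr x * 2 powr x" by (simp add: powr_divide)
    also have "\<dots> \<le> (3/2) powr 2 * 2 powr x" using x by (intro mult_right_mono powr_mono) auto
    finally have "3 powr x * ln 3 \<le> (3/2) powr 2 * 2 powr x * ln (3::real)"
      by (rule mult_right_mono) simp
    then have le: "3 powr x * ln 3 \<le> 2 powr x / 4 * (9 * ln (3::real))"
      by (simp add: power2_eq_square)
    have "9 * ln 3 < 16 * ln (2::real)"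
    proof -
      have "ln ((3::real) ^ 9) < ln (2 ^ 16)" by (subst ln_less_cancel_iff) auto
      then show ?thesis by (subst (asm) (1 2) ln_realpow) auto
    qed
    then have "2 powr x / 4 * (9 * ln 3) < 2 powr x / 4 * (16 * ln (2::real))"
      by (rule mult_strict_left_mono) simp
    with le have "3 powr x * ln 3 - 4 * (2 powr x * ln (2::real)) < 0" by linarith
    moreover have "(f has_real_derivative 3 powr x * ln 3 - 4 * (2 powr x * ln 2)) (at x)"
      unfolding f_def[abs_def] by (auto intro!: derivative_eq_intros)
    ultimately show "\<exists>y. (f has_real_derivative y) (at x) \<and> y < 0" by blast
  qed
  then show ?thesis by (simp add: f_def)
qed

text \<open>For \<open>l \<ge> 2\<close> the mean value points of the two sides are separated by
  \<open>l\<close>, and second differences with exponent \<open>s - 1\<close> increase. For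
  \<open>l = 1\<close> the left argument is 0, so a direct computation is needed.\<close>

lemma third_diff_powr_strict_mono:
  assumes "1 < s" "s < 2" "1 \<le> l"
  shows "third_diff_powr s (real l - 1) < third_diff_powr s (real l)"
proof (cases "l = 1")
  case True
  then show ?thesis using powr_3_4_2_pos[of s] assms by (simp add: third_diff_powr_def)
next
  case False
  then have l: "2 \<le> real l" using assms by simp
  obtain z where z: "real l < z" "third_diff_powr s (real l) = s * second_diff_powr (s - 1) z"
    using third_diff_powr_mvt[of s "real l"] assms l by auto
  obtain y where y: "real l - 1 < y" "y < real l"
      "third_diff_powr s (real l - 1) = s * second_diff_powr (s - 1) y"
    using third_diff_powr_mvt[of s "real l - 1"] assms l by auto
  show ?thesis
    using second_diff_powr_strict_mono[of "s - 1" y z] z y l assms by simp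
qed

section \<open>Entries and row sums\<close>

definition riesz_const :: "real \<Rightarrow> real \<Rightarrow> real" where
  "riesz_const \<beta> h = h powr (1 - 2 * \<beta>) / (2 * cos (\<beta> * pi) * Gamma (4 - 2 * \<beta>))"

lemma cos_times_pi_neg:
  assumes "1/2 < \<beta>" "\<beta> < 1"
  shows "cos (\<beta> * pi) < 0"
proof -
  have "0 < cos (pi - \<beta> * pi)"
  proof (rule cos_gt_zero_pi)
    have "1/2 * pi < \<beta> * pi" "\<beta> * pi < 1 * pi"
      using assms by (intro mult_strict_right_mono; simp)+
    then show "- (pi / 2) < pi - \<beta> * pi" "pi - \<beta> * pi < pi / 2" using pi_gt_zero by linarith+
  qed
  then show ?thesis by simp
qed

lemma riesz_const_neg:
  assumes "1/2 < \<beta>" "\<beta> < 1" "0 < h"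
  shows "riesz_const \<beta> h < 0"
  unfolding riesz_const_def using cos_times_pi_neg[OF assms(1,2)] Gamma_real_pos[of "4 - 2 * \<beta>"] assms
  by (simp add: divide_less_0_iff mult_less_0_iff)

text \<open>The absolute values in \<open>third_diff_powr\<close> merge the three cases of the
  definition into one fourth difference.\<close>

lemma riesz_stiffness_coeff_eq_nat:
  assumes "\<beta> < 1"
  shows "riesz_stiffness_coeff \<beta> h l = riesz_const \<beta> h *
     (third_diff_powr (3 - 2 * \<beta>) (real l) - third_diff_powr (3 - 2 * \<beta>) (real l - 1))"
proof -
  have 4: "2 powr (4 - 2 * \<beta>) = 2 * 2 powr (3 - 2 * \<beta>)"
    using powr_add[of 2 1 "3 - 2 * \<beta>"] by simp
  have 5: "2 powr (5 - 2 * \<beta>) = 4 * 2 powr (3 - 2 * \<beta>)"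
    using powr_add[of 2 2 "3 - 2 * \<beta>"] by simp
  consider "l = 0" | "l = 1" | "2 \<le> l" by linarith
  then show ?thesis
  proof cases
    case 3
    then have "2 \<le> real l" by simp
    then show ?thesis using 3
      by (simp add: riesz_stiffness_coeff_def riesz_const_def third_diff_powr_def algebra_simps)
  qed (simp_all add: riesz_stiffness_coeff_def riesz_const_def third_diff_powr_def 4 5)
qed

text \<open>Signed offsets turn a row into a sum over consecutive integers, which telescopes across
  the diagonal.\<close>

lemma riesz_stiffness_coeff_eq:
  assumes "\<beta> < 1"
  shows "riesz_stiffness_coeff \<beta> h (nat \<bar>k\<bar>) = riesz_const \<beta> h *
     (third_diff_powr (3 - 2 * \<beta>) (of_int k) - third_diff_powr (3 - 2 * \<beta>) (of_int k - 1))"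
proof (cases "0 \<le> k")
  case True
  then show ?thesis by (simp add: riesz_stiffness_coeff_eq_nat[OF assms])
next
  case False
  then show ?thesis
    using third_diff_powr_minus[of "3 - 2 * \<beta>" "of_int (- k)"]
      third_diff_powr_minus[of "3 - 2 * \<beta>" "of_int (- k) + 1"]
    by (simp add: riesz_stiffness_coeff_eq_nat[OF assms] minus_diff_commute algebra_simps)
qed

lemma riesz_stiffness_coeff_0_pos:
  assumes "1/2 < \<beta>" "\<beta> < 1" "0 < h"
  shows "0 < riesz_stiffness_coeff \<beta> h 0"
  using third_diff_powr_neg[of "3 - 2 * \<beta>" 0] third_diff_powr_minus[of "3 - 2 * \<beta>" 1] riesz_const_neg[OF assms] assms
  by (simp add: riesz_stiffness_coeff_eq_nat zero_less_mult_iff)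

lemma riesz_stiffness_coeff_neg:
  assumes "1/2 < \<beta>" "\<beta> < 1" "0 < h" "1 \<le> l"
  shows "riesz_stiffness_coeff \<beta> h l < 0"
  using third_diff_powr_strict_mono[of "3 - 2 * \<beta>" l] riesz_const_neg[OF assms(1-3)] assms
  by (simp add: riesz_stiffness_coeff_eq_nat mult_less_0_iff)

lemma riesz_stiffness_coeff_row_sum:
  assumes "\<beta> < 1" "i < n"
  shows "(\<Sum>j<n. riesz_stiffness_coeff \<beta> h (nat \<bar>int i - int j\<bar>)) = riesz_const \<beta> h *
     (third_diff_powr (3 - 2 * \<beta>) (real i) + third_diff_powr (3 - 2 * \<beta>) (real (n - 1 - i)))"
proof -
  \<comment> \<open>The partial sums include \<open>m \<le> i\<close>, where the argument is
    negative, hence real instead of truncated subtraction. For \<open>m = 0\<close> the two terms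
    cancel by antisymmetry.\<close>
  have "(\<Sum>j<m. riesz_stiffness_coeff \<beta> h (nat \<bar>int i - int j\<bar>)) = riesz_const \<beta> h *
     (third_diff_powr (3 - 2 * \<beta>) (real m - 1 - real i) + third_diff_powr (3 - 2 * \<beta>) (real i))" for m
  proof (induction m)
    case 0
    have "real 0 - 1 - real i = - (real i + 1)" by simp
    then have "third_diff_powr (3 - 2 * \<beta>) (real 0 - 1 - real i) = - third_diff_powr (3 - 2 * \<beta>) (real i)"
      by (simp only: third_diff_powr_minus) simp
    then show ?case by (simp only: lessThan_0 sum.empty add.left_inverse mult_zero_right)
  next
    case (Suc m)
    have "\<bar>int i - int m\<bar> = \<bar>int m - int i\<bar>" by simp
    then have "riesz_stiffness_coeff \<beta> h (nat \<bar>int i - int m\<bar>) = riesz_const \<beta> h *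
      (third_diff_powr (3 - 2 * \<beta>) (real m - real i)
        - third_diff_powr (3 - 2 * \<beta>) (real m - real i - 1))"
      using riesz_stiffness_coeff_eq[OF assms(1), of h "int m - int i"] by simp
    then show ?case using Suc by (simp add: algebra_simps)
  qed
  moreover have "real n - 1 - real i = real (n - 1 - i)" using assms(2) by linarith
  ultimately show ?thesis by (simp only: add.commute)
qed

section \<open>Diagonally dominant M-matrices\<close>

text \<open>At an index \<open>k\<close> minimizing \<open>x\<close>, nonpositive off-diagonal
  entries bound \<open>(A *\<^sub>v x) $ k\<close> above by the row sum times \<open>x $ k\<close>,
  so the minimum is nonnegative.\<close>

lemma minimum_principle:
  fixes A :: "real mat" and x :: "real Matrix.vec"
  assumes A: "A \<in> carrier_mat n n"
    and off: "\<And>i j. i < n \<Longrightarrow> j < n \<Longrightarrow> i \<noteq> j \<Longrightarrow> A $$ (i, j) \<le> 0"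
    and row: "\<And>i. i < n \<Longrightarrow> 0 < (\<Sum>j<n. A $$ (i, j))"
    and x: "x \<in> carrier_vec n"
    and Ax: "\<And>i. i < n \<Longrightarrow> 0 \<le> (A *\<^sub>v x) $ i"
    and "i < n"
  shows "0 \<le> x $ i"
proof -
  obtain k where k: "k < n" "\<And>j. j < n \<Longrightarrow> x $ k \<le> x $ j"
    using \<open>i < n\<close> ex_is_arg_min_if_finite[of "{..<n}" "vec_index x"]
    by (auto simp: is_arg_min_linorder)
  have "0 \<le> (A *\<^sub>v x) $ k" using Ax k by simp
  also have "\<dots> = (\<Sum>j<n. A $$ (k, j) * x $ j)"
    using A x k by (simp add: scalar_prod_def atLeast0LessThan)
  also have "\<dots> \<le> (\<Sum>j<n. A $$ (k, j) * x $ k)"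
  proof (rule sum_mono)
    fix j assume "j \<in> {..<n}"
    then show "A $$ (k, j) * x $ j \<le> A $$ (k, j) * x $ k"
      using off[of k j] k by (cases "j = k") (auto intro: mult_left_mono_neg)
  qed
  also have "\<dots> = (\<Sum>j<n. A $$ (k, j)) * x $ k" by (simp add: sum_distrib_right)
  finally have "0 \<le> x $ k" using row[OF k(1)] by (simp add: zero_le_mult_iff)
  then show ?thesis using k(2)[OF \<open>i < n\<close>] by simp
qed

text \<open>The minimum principle for a kernel vector and its negative gives invertibility; for the
  columns of the inverse, which \<open>A\<close> maps to unit vectors, it gives
  nonnegativity.\<close>

lemma M_matrix_if_row_sums_pos:
  fixes A :: "real mat"
  assumes A: "A \<in> carrier_mat n n"
    and off: "\<And>i j. i < n \<Longrightarrow> j < n \<Longrightarrow> i \<noteq> j \<Longrightarrow> A $$ (i, j) \<le> 0"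
    and row: "\<And>i. i < n \<Longrightarrow> 0 < (\<Sum>j<n. A $$ (i, j))"
  shows "M_matrix A"
proof -
  note min = minimum_principle[OF A off row]
  have "det A \<noteq> 0"
  proof
    assume "det A = 0"
    then obtain v where v: "v \<in> carrier_vec n" "v \<noteq> 0\<^sub>v n" "A *\<^sub>v v = 0\<^sub>v n"
      using det_0_iff_vec_prod_zero[OF A] by blast
    have w: "A *\<^sub>v (-1 \<cdot>\<^sub>v v) = 0\<^sub>v n"
      unfolding mult_mat_vec[OF A v(1)] v(3) by (intro eq_vecI) auto
    have "v $ i = 0" if "i < n" for i
      using min[of v i] min[of "-1 \<cdot>\<^sub>v v" i] v w that by auto
    then show False using v by auto
  qed
  then have "A \<in> Units (ring_mat TYPE(real) n ())" by (rule det_non_zero_imp_unit[OF A])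
  then obtain B where B: "B \<in> carrier_mat n n" "A * B = 1\<^sub>m n" "B * A = 1\<^sub>m n"
    by (auto simp: Units_def ring_mat_def)
  have "0 \<le> B $$ (i, j)" if "i < n" "j < n" for i j
  proof -
    have "A *\<^sub>v col B j = unit_vec n j"
      using col_mult2[OF A B(1) that(2)] B that by simp
    then have "0 \<le> (A *\<^sub>v col B j) $ k" if "k < n" for k
      using that by (simp add: unit_vec_def)
    moreover have "col B j \<in> carrier_vec n" using B(1) by (simp add: carrier_vecI)
    ultimately have "0 \<le> col B j $ i" using min that(1) by blast
    then show ?thesis using that B by simp
  qed
  then show ?thesis
    unfolding M_matrix_def inverts_mat_def using A B off by auto
qed

section \<open>Interior row sums\<close>

text \<open>Two Gamma recursions absorb the factors s(s - 1) of the third-difference bound, with s =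
  3 - 2 \<open>\<beta>\<close>.\<close>

lemma riesz_const_eq:
  assumes "\<beta> < 1"
  shows "riesz_const \<beta> h * ((3 - 2 * \<beta>) * (2 - 2 * \<beta>))
    = h powr (1 - 2 * \<beta>) / (2 * cos (\<beta> * pi) * Gamma (2 - 2 * \<beta>))"
proof -
  have "Gamma (3 - 2 * \<beta>) = (2 - 2 * \<beta>) * Gamma (2 - 2 * \<beta>)"
    using Gamma_plus1[of "2 - 2 * \<beta>"] assms by (simp add: nonpos_Ints_def)
  moreover have "Gamma (4 - 2 * \<beta>) = (3 - 2 * \<beta>) * Gamma (3 - 2 * \<beta>)"
    using Gamma_plus1[of "3 - 2 * \<beta>"] assms by (simp add: nonpos_Ints_def)
  ultimately show ?thesis using assms by (simp add: riesz_const_def)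
qed

text \<open>Convexity replaces \<open>p + 1\<close> and \<open>q + 1\<close> by their mean, which is
  at most 1/(2h), so the bound no longer depends on the row.\<close>

lemma third_diff_powr_add_le:
  assumes "1 < s" "s < 2" "1 \<le> p" "1 \<le> q" "0 < h" "h * (p + q + 2) \<le> 1"
  shows "third_diff_powr s p + third_diff_powr s q
    \<le> - (2 * (s * (s - 1) * (2 - s)) * (2 * h) powr (3 - s))"
proof -
  define c where "c = s * (s - 1) * (2 - s)"
  have "(2 * h) powr (3 - s) = (1 / (2 * h)) powr (s - 3)"
    using assms powr_minus_divide[of "2 * h" "s - 3"] by (simp add: powr_divide)
  also have "\<dots> \<le> ((p + q + 2) / 2) powr (s - 3)"
    using assms by (intro powr_mono2') (auto simp: field_simps)
  finally have "2 * (2 * h) powr (3 - s) \<le> 2 * ((p + q + 2) / 2) powr (s - 3)" by simp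
  also have "\<dots> \<le> (p + 1) powr (s - 3) + (q + 1) powr (s - 3)"
    using powr_midpoint_le[of "p + 1" "q + 1" "s - 3"] assms by (simp add: algebra_simps)
  finally have "c * (2 * (2 * h) powr (3 - s)) \<le> c * ((p + 1) powr (s - 3) + (q + 1) powr (s - 3))"
    using assms by (intro mult_left_mono) (auto simp: c_def)
  moreover have "third_diff_powr s p \<le> - (c * (p + 1) powr (s - 3))"
      "third_diff_powr s q \<le> - (c * (q + 1) powr (s - 3))"
    using third_diff_powr_le assms by (simp_all add: c_def)
  ultimately show ?thesis unfolding c_def[symmetric] by (simp add: distrib_left mult.assoc)
qed

lemma riesz_interior_row_bound:
  assumes "1/2 < \<beta>" "\<beta> < 1" "1 \<le> p" "1 \<le> q" "0 < h" "h * (p + q + 2) \<le> 1"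
  shows "- (2 powr (2 * \<beta>) * h * (2 * \<beta> - 1) / (cos (\<beta> * pi) * Gamma (2 - 2 * \<beta>)))
    \<le> riesz_const \<beta> h * (third_diff_powr (3 - 2 * \<beta>) p + third_diff_powr (3 - 2 * \<beta>) q)"
    (is "?L \<le> _ * ?T")
proof -
  have "h powr (1 - 2 * \<beta>) * (2 * h) powr (2 * \<beta>) = 2 powr (2 * \<beta>) * h"
    using assms powr_add[of h "1 - 2 * \<beta>" "2 * \<beta>"] by (simp add: powr_mult)
  \<comment> \<open>To be used with \<open>p\<close>, \<open>q\<close> the two powers of
    \<open>h\<close> multiplied above. Division by zero yields 0, so no side condition
    arises.\<close>
  moreover have "- (p * q * e / (c * g)) = p / (2 * c * g) * - (2 * e * q)" for p q e c g :: real
    by (simp add: divide_simps)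
  ultimately have "?L = h powr (1 - 2 * \<beta>) / (2 * cos (\<beta> * pi) * Gamma (2 - 2 * \<beta>))
      * - (2 * (2 * \<beta> - 1) * (2 * h) powr (2 * \<beta>))"
    by metis
  also have "\<dots> = riesz_const \<beta> h *
      - (2 * ((3 - 2 * \<beta>) * (2 - 2 * \<beta>) * (2 * \<beta> - 1)) * (2 * h) powr (2 * \<beta>))"
    unfolding riesz_const_eq[OF assms(2), symmetric] by (simp add: algebra_simps)
  also have "\<dots> \<le> riesz_const \<beta> h * ?T"
    using third_diff_powr_add_le[of "3 - 2 * \<beta>" p q h] riesz_const_neg[of \<beta> h] assms
    by (intro mult_left_mono_neg) (auto simp: algebra_simps)
  finally show ?thesis .
qed

theorem theorem1:
  fixes \<beta> a b h :: real and M :: nat and A :: "real mat"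
  assumes "1/2 < \<beta>" "\<beta> < 1"
    and "a < b"
    and "1 \<le> M"
    and "h = (b - a) / real M"
    and "A = riesz_stiffness_mat \<beta> h M"
  shows "transpose_mat A = A \<and>
    (\<forall>i\<in>{1..M-1}. 0 < A $$ (i - 1, i - 1)) \<and>
    (\<forall>i\<in>{1..M-1}. \<forall>j\<in>{1..M-1}. i \<noteq> j \<longrightarrow> A $$ (i - 1, j - 1) < 0) \<and>
    (\<forall>i\<in>{1..M-1}. 0 < (\<Sum>j=1..M-1. A $$ (i - 1, j - 1))) \<and>
    (h \<le> 1/7 \<longrightarrow>
       (\<forall>i\<in>{1..M-1}. i = 1 \<or> i = M - 1 \<longrightarrow>
          (\<Sum>j=1..M-1. A $$ (i - 1, j - 1)) \<ge>
            - (h powr (1 - 2 * \<beta>) * (4 - 2 powr (3 - 2 * \<beta>)) /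
               (2 * cos (\<beta> * pi) * Gamma (4 - 2 * \<beta>))))) \<and>
    (h \<le> 1/7 \<and> b - a \<le> 1 \<longrightarrow>
       (\<forall>i\<in>{2..M-2}.
          (\<Sum>j=1..M-1. A $$ (i - 1, j - 1)) \<ge>
            - (2 powr (2 * \<beta>) * h * (2 * \<beta> - 1) /
               (cos (\<beta> * pi) * Gamma (2 - 2 * \<beta>))))) \<and>
    M_matrix A"
proof -
  define K where "K = riesz_const \<beta> h"
  define T where "T n = third_diff_powr (3 - 2 * \<beta>) (real n)" for n
  have h: "0 < h" and M: "h * real M = b - a" using assms by simp_all
  have K: "K < 0" using riesz_const_neg assms h by (simp add: K_def)
  have T: "T n < 0" for n using third_diff_powr_neg assms by (simp add: T_def)
  have dim: "A \<in> carrier_mat (M - 1) (M - 1)" using assms by (simp add: riesz_stiffness_mat_def)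
  have entry: "A $$ (i, j) = riesz_stiffness_coeff \<beta> h (nat \<bar>int i - int j\<bar>)"
    if "i < M - 1" "j < M - 1" for i j
    using that assms by (simp add: riesz_stiffness_mat_def)
  have sym: "transpose_mat A = A"
    using dim by (intro eq_matI) (auto simp: entry abs_minus_commute)
  have diag: "0 < A $$ (i, i)" if "i < M - 1" for i
    using riesz_stiffness_coeff_0_pos[OF assms(1,2) h] that by (simp add: entry)
  have off: "A $$ (i, j) < 0" if "i < M - 1" "j < M - 1" "i \<noteq> j" for i j
    using riesz_stiffness_coeff_neg[OF assms(1,2) h, of "nat \<bar>int i - int j\<bar>"] that by (simp add: entry)
  have row0: "(\<Sum>j<M-1. A $$ (i, j)) = K * (T i + T (M - 1 - 1 - i))" if "i < M - 1" for i
    using riesz_stiffness_coeff_row_sum[of \<beta> i "M - 1" h] that assms(2)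
    by (simp add: K_def T_def entry)
  have row: "(\<Sum>j=1..M-1. A $$ (i - 1, j - 1)) = K * (T (i - 1) + T (M - 1 - i))"
    if "i \<in> {1..M-1}" for i
  proof -
    have "(\<Sum>j=1..M-1. A $$ (i - 1, j - 1)) = (\<Sum>j<M-1. A $$ (i - 1, j))"
      using sum.atLeast1_atMost_eq[of "\<lambda>j. A $$ (i - 1, j - 1)" "M - 1"] by simp
    moreover have "M - 1 - 1 - (i - 1) = M - 1 - i" using that by auto
    ultimately show ?thesis using row0[of "i - 1"] that by auto
  qed
  have pos: "0 < K * (T m + T n)" for m n
    using K T[of m] T[of n] by (simp add: zero_less_mult_iff)
  \<comment> \<open>The bound for the first and last rows is exactly the contribution of
    \<open>T 0\<close>; the other summand is positive.\<close>
  have KT0: "- (h powr (1 - 2 * \<beta>) * (4 - 2 powr (3 - 2 * \<beta>)) /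
      (2 * cos (\<beta> * pi) * Gamma (4 - 2 * \<beta>))) = K * T 0"
    by (simp add: K_def T_def riesz_const_def third_diff_powr_0 minus_divide_left algebra_simps)
  have outer: "K * T 0 \<le> (\<Sum>j=1..M-1. A $$ (i - 1, j - 1))"
    if "i \<in> {1..M-1}" "i = 1 \<or> i = M - 1" for i
  proof -
    have "0 < K * T n" for n using K T by (simp add: zero_less_mult_iff)
    then show ?thesis using row[OF that(1)] that(2) by (auto simp: distrib_left less_imp_le)
  qed
  \<comment> \<open>With p = i - 1 and q = M - 1 - i, p + q + 2 is \<open>M\<close>; as
    \<open>h * real M = b - a\<close>, the assumption \<open>b - a \<le> 1\<close> supplies the mesh
    condition.\<close>
  have inner: "- (2 powr (2 * \<beta>) * h * (2 * \<beta> - 1) / (cos (\<beta> * pi) * Gamma (2 - 2 * \<beta>)))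
      \<le> (\<Sum>j=1..M-1. A $$ (i - 1, j - 1))" if "b - a \<le> 1" "i \<in> {2..M-2}" for i
  proof -
    have "real (i - 1) + real (M - 1 - i) + 2 = real M" using that by auto
    moreover have "1 \<le> real (i - 1)" "1 \<le> real (M - 1 - i)" using that by auto
    ultimately show ?thesis
      using riesz_interior_row_bound[of \<beta> "real (i - 1)" "real (M - 1 - i)" h] row[of i] assms(1,2)
        h M that by (auto simp: K_def T_def)
  qed
  have "M_matrix A"
    using M_matrix_if_row_sums_pos[OF dim] off row0 pos by (simp add: less_imp_le)
  then show ?thesis
    using sym diag off row pos outer inner unfolding KT0 by auto
qed

end
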